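(* Let $(S,\preccurlyeq)$ be a preordered semiring of polynomial growth such that the canonical map $\mathbb{N}\hookrightarrow S$ is an order embedding, let $M\subseteq S$, and let $S_0$ be the subsemiring of $S$ generated by $M$. Suppose that (M1) for all $s\in S\setminus\{0\}$ there exist $m\in M$ and $n\in\mathbb{N}$ such that $1\preccurlyeq nms$ and $ms\preccurlyeq n$; (M2) for all $m\in M$ such that the evaluation map $\operatorname{ev}_m:\Delta(S_0,\preccurlyeq)\to\mathbb{R}_{\ge 0}$ is bounded there is an $n\in\mathbb{N}$ such that $m\preccurlyeq n$. Then for every $x,y\in S$ we have $$x\succsim y\iff\forall f\in\Delta(S,\preccurlyeq):f(x)\ge f(y).$$ Moreover, $\Delta(S,\preccurlyeq)$ is a nonempty locally compact Hausdorff space, and if $u\in S$ is power universal then $\operatorname{ev}_u:\Delta(S,\preccurlyeq)\to\mathbb{R}_{\ge 0}$ is proper.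
   Context: A semiring is a set with commutative and associative operations $+$ and $\cdot$ with neutral elements $0$ and $1$ respectively, such that $0\cdot a=0$ and $a(b+c)=ab+ac$. Semiring homomorphisms preserve $0,1,+,\cdot$; a subsemiring contains $0$ and $1$. $\mathbb{N}=\{0,1,2,\ldots\}$, and $n\in\mathbb{N}$ also denotes its image $n\cdot 1$ in a semiring under the canonical map. A preordered semiring is a pair $(S,\preccurlyeq)$ with $S$ a semiring and $\preccurlyeq$ a reflexive transitive relation on $S$ such that $0\preccurlyeq 1$ and $a\preccurlyeq b$ implies $a+c\preccurlyeq b+c$ and $ac\preccurlyeq bc$ for all $c\in S$. We write $b\succcurlyeq a$ for $a\preccurlyeq b$. The canonical map $\mathbb{N}\to S$ is an order embedding if $n\preccurlyeq m\iff n\le m$ for $n,m\in\mathbb{N}$. Subsemirings carry the restricted preorder, denoted by the same symbol. An element $u\in S$ is power universal if $u\succcurlyeq 1$ and for every $x\in S\setminus\{0\}$ there is a $k\in\mathbb{N}$ such that $x\preccurlyeq u^k$ and $u^kx\succcurlyeq 1$. $S$ is of polynomial growth if it has a power universal element. Asymptotic preorder: for $(S,\preccurlyeq)$ of polynomial growth and $u$ power universal, $x\succsim y$ iff there is a sequence $(k_n)_{n\in\mathbb{N}}$ of nonnegative integers with $\lim_{n\to\infty}k_n/n=0$ and $u^{k_n}x^n\succcurlyeq y^n$ for all $n\in\mathbb{N}$ (this relation does not depend on the choice of $u$). The spectrum $\Delta(S,\preccurlyeq)$ is the set of semiring homomorphisms $f:S\to\mathbb{R}_{\ge 0}$ that are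 monotone ($x\preccurlyeq y\implies f(x)\le f(y)$), with the initial topology with respect to the evaluation maps $\operatorname{ev}_s:f\mapsto f(s)$, $s\in S$. A map is proper if preimages of compact sets are compact. *)

theory Defs
  imports "HOL-Analysis.Analysis"
begin

text \<open>
  The semiring is the universe of a type of class \<open>comm_semiring_1\<close>. This class also
  requires \<open>0 \<noteq> 1\<close>, which follows anyway as soon as the canonical map from the natural
  numbers (\<open>of_nat\<close>) is an order embedding. The preorder is an explicit relation rather
  than a class operation, since it need not be antisymmetric.
\<close>

locale preordered_semiring =
  fixes le :: "'a::comm_semiring_1 \<Rightarrow> 'a \<Rightarrow> bool"  (infix "\<preceq>" 50)
  assumes refl: "a \<preceq> a"
    and trans: "a \<preceq> b \<Longrightarrow> b \<preceq> c \<Longrightarrow> a \<preceq> c"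
    and zero_le_one: "0 \<preceq> 1"
    and add_right_mono: "a \<preceq> b \<Longrightarrow> a + c \<preceq> b + c"
    and mult_right_mono: "a \<preceq> b \<Longrightarrow> a * c \<preceq> b * c"

definition nat_order_embedding :: "('a::comm_semiring_1 \<Rightarrow> 'a \<Rightarrow> bool) \<Rightarrow> bool" where
  "nat_order_embedding le \<longleftrightarrow> (\<forall>n m :: nat. le (of_nat n) (of_nat m) \<longleftrightarrow> n \<le> m)"

definition power_universal :: "('a::comm_semiring_1 \<Rightarrow> 'a \<Rightarrow> bool) \<Rightarrow> 'a \<Rightarrow> bool" where
  "power_universal le u \<longleftrightarrow>
     le 1 u \<and> (\<forall>x. x \<noteq> 0 \<longrightarrow> (\<exists>k::nat. le x (u ^ k) \<and> le 1 (u ^ k * x)))"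

definition polynomial_growth :: "('a::comm_semiring_1 \<Rightarrow> 'a \<Rightarrow> bool) \<Rightarrow> bool" where
  "polynomial_growth le \<longleftrightarrow> (\<exists>u. power_universal le u)"

text \<open>
  \<open>asymptotic_ge le u x y\<close> is the relation \<open>x \<succsim> y\<close> computed with the element \<open>u\<close>; it is
  meant for power universal \<open>u\<close>, among which the choice is immaterial. The term \<open>n = 0\<close>
  of \<open>k n / n\<close> is irrelevant for the limit.
\<close>

definition asymptotic_ge ::
    "('a::comm_semiring_1 \<Rightarrow> 'a \<Rightarrow> bool) \<Rightarrow> 'a \<Rightarrow> 'a \<Rightarrow> 'a \<Rightarrow> bool" where
  "asymptotic_ge le u x y \<longleftrightarrow>
     (\<exists>k :: nat \<Rightarrow> nat. (\<lambda>n. real (k n) / real n) \<longlonglongrightarrow> 0 \<and>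
        (\<forall>n. le (y ^ n) (u ^ k n * x ^ n)))"

definition subsemiring :: "'a::comm_semiring_1 set \<Rightarrow> bool" where
  "subsemiring A \<longleftrightarrow> 0 \<in> A \<and> 1 \<in> A \<and> (\<forall>a\<in>A. \<forall>b\<in>A. a + b \<in> A \<and> a * b \<in> A)"

definition generated_subsemiring :: "'a::comm_semiring_1 set \<Rightarrow> 'a set" where
  "generated_subsemiring M = subsemiring hull M"

definition semiring_hom_on ::
    "'a::comm_semiring_1 set \<Rightarrow> ('a \<Rightarrow> 'b::comm_semiring_1) \<Rightarrow> bool" where
  "semiring_hom_on A f \<longleftrightarrow> f 0 = 0 \<and> f 1 = 1 \<and>
     (\<forall>a\<in>A. \<forall>b\<in>A. f (a + b) = f a + f b \<and> f (a * b) = f a * f b)"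

text \<open>
  The spectrum of a subsemiring \<open>A\<close> with the restricted preorder. A map on \<open>A\<close> is
  represented by its extensional representative (\<open>undefined\<close> outside \<open>A\<close>), so that distinct
  elements of the spectrum differ on \<open>A\<close>. For \<open>A = UNIV\<close> this is no restriction.
\<close>

definition spectrum :: "'a::comm_semiring_1 set \<Rightarrow> ('a \<Rightarrow> 'a \<Rightarrow> bool) \<Rightarrow> ('a \<Rightarrow> real) set" where
  "spectrum A le =
     {f \<in> A \<rightarrow>\<^sub>E {0..}. semiring_hom_on A f \<and> monotone_on A le (\<le>) f}"

definition ev :: "'a \<Rightarrow> ('a \<Rightarrow> real) \<Rightarrow> real" where
  "ev s f = f s"

abbreviation nonneg_reals :: "real topology" where
  "nonneg_reals \<equiv> top_of_set {0..}"

definition spectrum_topology ::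
    "'a::comm_semiring_1 set \<Rightarrow> ('a \<Rightarrow> 'a \<Rightarrow> bool) \<Rightarrow> ('a \<Rightarrow> real) topology" where
  "spectrum_topology A le = topology_generated_by
     {{f \<in> spectrum A le. ev s f \<in> U} | s U. s \<in> A \<and> openin nonneg_reals U}"

lemma topspace_spectrum_topology:
  assumes "A \<noteq> {}"
  shows "topspace (spectrum_topology A le) = spectrum A le"
proof
  show "topspace (spectrum_topology A le) \<subseteq> spectrum A le"
    by (auto simp: spectrum_topology_def topology_generated_by_topspace)
  from assms obtain s where s: "s \<in> A" by blast
  have "spectrum A le = {f \<in> spectrum A le. ev s f \<in> {0..}}"
    using s by (auto simp: spectrum_def ev_def PiE_def Pi_def)
  moreover have "openin nonneg_reals {0..}"
    by simp
  ultimately show "spectrum A le \<subseteq> topspace (spectrum_topology A le)"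
    unfolding spectrum_topology_def topology_generated_by_topspace using s by blast
qed

text \<open>
  Properness in the sense that preimages of compact sets are compact. The library's
  \<open>proper_map\<close> (closed with compact fibres) is a different notion in general.
\<close>

definition compact_preimage_map ::
    "'b topology \<Rightarrow> 'c topology \<Rightarrow> ('b \<Rightarrow> 'c) \<Rightarrow> bool" where
  "compact_preimage_map X Y g \<longleftrightarrow> g \<in> topspace X \<rightarrow> topspace Y \<and>
     (\<forall>K. compactin Y K \<longrightarrow> compactin X {x \<in> topspace X. g x \<in> K})"

end

theory Submission
  imports Defs
begin

text \<open>
  Let \<open>f x \<ge> f y\<close> for all \<open>f\<close> in the spectrum \<open>\<Delta>(S)\<close>, with \<open>x, y \<noteq> 0\<close>, and let \<open>u\<close> be
  power universal. Inequalities on \<open>\<Delta>(S)\<close> have to be turned into inequalities in \<open>S\<close>, and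
  three ingredients do this.

  First, the Archimedean case (Strassen): if every nonzero element of a preordered semiring
  that contains the natural numbers in their usual order lies between positive rational
  constants, then monotone homomorphisms to the nonnegative reals exist. More generally
  (\<open>extend_hom\<close>), a monotone homomorphism \<open>\<phi>\<close> on a subsemiring \<open>A\<close> extends to \<open>S\<close> as soon as
  every nonzero element of \<open>S\<close> can be multiplied by an element of \<open>A\<close> into such a range of
  constants. The extension is the real number that a Dedekind cut assigns to an element under
  a maximal preorder for which \<open>\<phi>\<close> stays monotone. Such a preorder is total, because a new
  inequality \<open>a \<preceq> b\<close> can be adjoined by \<open>v \<preceq>' w \<longleftrightarrow> (\<exists>z. v + z b \<preceq> w + z a)\<close> unless that
  violates \<open>\<phi>\<close>, and it also contains the order that \<open>\<phi>\<close> induces on \<open>A\<close> (\<open>adjoin_scalar\<close>).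

  Second, upper bounds up to constants are visible on the spectrum (\<open>spectral_bound\<close>): if
  \<open>f y \<le> C f x\<close> on \<open>\<Delta>(S)\<close>, then \<open>y \<preceq> n x\<close> for some \<open>n\<close>. By (M1) the quotient \<open>y / x\<close> agrees
  up to constants with some \<open>m \<in> M\<close>; by the extension theorem \<open>m\<close> is bounded on \<open>\<Delta>(S\<^sub>0)\<close>; now
  (M2) applies.

  Third, the factor \<open>u ^ k\<close> permitted in the asymptotic preorder makes the preorders under
  which \<open>u\<close> is infinite harmless (\<open>power_comparison\<close>). Fix \<open>q\<close>, put \<open>a = 2 u x ^ q\<close> and
  \<open>b = y ^ q\<close>, and adjoin \<open>a \<preceq> b\<close>. As \<open>y \<preceq> N x\<close> by the second step, this bounds \<open>u\<close> by a
  constant, so the new preorder is Archimedean. A monotone homomorphism for it would satisfy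
  \<open>2 f(u) f(x) ^ q \<le> f(y) ^ q \<le> f(x) ^ q\<close>, which is impossible. So the natural numbers must
  collapse: \<open>c + 1 + z b \<preceq> c + z a\<close> for some \<open>c\<close> and \<open>z\<close>. This gives \<open>1 \<le> f(z a)\<close> on the
  spectrum, so the constant \<open>c\<close> is dominated by a multiple of \<open>z a\<close>, again by the second
  step, and \<open>r z b \<preceq> r z (2 a)\<close> follows for some \<open>r\<close>. Iteration yields
  \<open>y ^ (q n) \<preceq> u ^ E (4 u) ^ n x ^ (q n)\<close> for all \<open>n\<close>. The exponent of \<open>u\<close> per power of \<open>y\<close>
  is \<open>O(1 / q)\<close>, and \<open>q\<close> is arbitrary.

  The topological assertions hold because the spectrum is a closed subset of a product of
  real lines in which a bound on \<open>f u\<close> bounds every coordinate.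
\<close>

section \<open>Arithmetic in preordered semirings\<close>

context preordered_semiring
begin

declare trans [trans]

lemma zero_le: "0 \<preceq> x"
  using mult_right_mono[OF zero_le_one, of x] by simp

lemma mult_left_mono: "a \<preceq> b \<Longrightarrow> c * a \<preceq> c * b"
  using mult_right_mono[of a b c] by (simp add: mult.commute)

lemma add_left_mono: "a \<preceq> b \<Longrightarrow> c + a \<preceq> c + b"
  using add_right_mono[of a b c] by (simp add: add.commute)

lemma add_mono: "a \<preceq> b \<Longrightarrow> c \<preceq> d \<Longrightarrow> a + c \<preceq> b + d"
  by (rule trans[OF add_right_mono add_left_mono])

lemma mult_mono: "a \<preceq> b \<Longrightarrow> c \<preceq> d \<Longrightarrow> a * c \<preceq> b * d"
  by (rule trans[OF mult_right_mono mult_left_mono])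

lemma power_mono: "a \<preceq> b \<Longrightarrow> a ^ n \<preceq> b ^ n"
  by (induction n) (auto intro: refl mult_mono)

lemma le_add_left: "x \<preceq> x + y"
  using add_left_mono[OF zero_le, of x y] by simp

lemma of_nat_mono: "n \<le> m \<Longrightarrow> of_nat n \<preceq> of_nat m"
  using le_add_left[of "of_nat n" "of_nat (m - n)"] by (simp flip: of_nat_add)

lemma power_increasing: "1 \<preceq> u \<Longrightarrow> k \<le> l \<Longrightarrow> u ^ k \<preceq> u ^ l"
  using mult_left_mono[OF power_mono[of 1 u "l - k"], of "u ^ k"]
  by (simp flip: power_add)

text \<open>
  A common summand need not cancel, but the inequality can be repeated while the summand is
  used only once; compared with many copies of the other terms, the summand is negligible.
\<close>

lemma iterate_common_summand:
  assumes "x + w \<preceq> y + w"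
  shows "of_nat k * x + w \<preceq> of_nat k * y + w"
proof (induction k)
  case (Suc k)
  have "of_nat (Suc k) * x + w = of_nat k * x + (x + w)"
    by (simp add: algebra_simps)
  also have "\<dots> \<preceq> of_nat k * x + (y + w)"
    by (rule add_left_mono[OF assms])
  finally have "of_nat (Suc k) * x + w \<preceq> y + (of_nat k * x + w)"
    by (simp add: algebra_simps)
  moreover have "y + (of_nat k * x + w) \<preceq> y + (of_nat k * y + w)"
    by (rule add_left_mono[OF Suc])
  ultimately show ?case
    using trans by (fastforce simp: algebra_simps)
qed (simp add: refl)

lemma iterate_common_factor:
  assumes "v * x \<preceq> v * y"
  shows "v * x ^ n \<preceq> v * y ^ n"
proof (induction n)
  case (Suc n)
  have "v * x ^ Suc n = v * x * x ^ n"
    by (simp add: algebra_simps)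
  also have "\<dots> \<preceq> v * y * x ^ n"
    by (rule mult_right_mono[OF assms])
  finally have "v * x ^ Suc n \<preceq> y * (v * x ^ n)"
    by (simp add: algebra_simps)
  moreover have "y * (v * x ^ n) \<preceq> y * (v * y ^ n)"
    by (rule mult_left_mono[OF Suc])
  ultimately show ?case
    using trans by (fastforce simp: algebra_simps)
qed (simp add: refl)

end

lemma le_if_multiples_le:
  fixes a b c :: real
  assumes "\<And>k::nat. real k * a \<le> real k * b + c"
  shows "a \<le> b"
proof (rule ccontr)
  assume "\<not> a \<le> b"
  then obtain k :: nat where "c < real k * (a - b)"
    using reals_Archimedean3[of "a - b"] by auto
  with assms[of k] show False
    by (simp add: algebra_simps)
qed

section \<open>Subsemirings and their spectra\<close>

lemma subsemiring_0: "subsemiring A \<Longrightarrow> 0 \<in> A"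
  and subsemiring_1: "subsemiring A \<Longrightarrow> 1 \<in> A"
  and subsemiring_add: "subsemiring A \<Longrightarrow> a \<in> A \<Longrightarrow> b \<in> A \<Longrightarrow> a + b \<in> A"
  and subsemiring_mult: "subsemiring A \<Longrightarrow> a \<in> A \<Longrightarrow> b \<in> A \<Longrightarrow> a * b \<in> A"
  by (auto simp: subsemiring_def)

lemma subsemiring_of_nat: "subsemiring A \<Longrightarrow> of_nat n \<in> A"
  by (induction n) (auto intro: subsemiring_0 subsemiring_1 subsemiring_add)

lemma subsemiring_power: "subsemiring A \<Longrightarrow> a \<in> A \<Longrightarrow> a ^ n \<in> A"
  by (induction n) (auto intro: subsemiring_1 subsemiring_mult)

lemmas subsemiring_closed =
  subsemiring_0 subsemiring_1 subsemiring_add subsemiring_mult subsemiring_of_nat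
  subsemiring_power

lemma subsemiring_UNIV: "subsemiring UNIV"
  by (simp add: subsemiring_def)

lemma subsemiring_generated: "subsemiring (generated_subsemiring M)"
  unfolding generated_subsemiring_def
  by (rule hull_in) (auto simp: subsemiring_def)

lemma subset_generated_subsemiring: "M \<subseteq> generated_subsemiring M"
  unfolding generated_subsemiring_def by (rule hull_subset)

context
  fixes A :: "'a::comm_semiring_1 set" and le :: "'a \<Rightarrow> 'a \<Rightarrow> bool" and f :: "'a \<Rightarrow> real"
  assumes f: "f \<in> spectrum A le"
begin

lemma spectrum_nonneg: "a \<in> A \<Longrightarrow> 0 \<le> f a"
  using f by (auto simp: spectrum_def PiE_def Pi_def)

lemma spectrum_0: "f 0 = 0"
  and spectrum_1: "f 1 = 1"
  and spectrum_add: "a \<in> A \<Longrightarrow> b \<in> A \<Longrightarrow> f (a + b) = f a + f b"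
  and spectrum_mult: "a \<in> A \<Longrightarrow> b \<in> A \<Longrightarrow> f (a * b) = f a * f b"
  using f by (auto simp: spectrum_def semiring_hom_on_def)

lemma spectrum_mono: "a \<in> A \<Longrightarrow> b \<in> A \<Longrightarrow> le a b \<Longrightarrow> f a \<le> f b"
  using f by (auto simp: spectrum_def monotone_on_def)

lemma spectrum_of_nat: "subsemiring A \<Longrightarrow> f (of_nat n) = real n"
  by (induction n) (auto simp: spectrum_0 spectrum_1 spectrum_add subsemiring_closed)

lemma spectrum_power: "subsemiring A \<Longrightarrow> a \<in> A \<Longrightarrow> f (a ^ n) = f a ^ n"
  by (induction n) (auto simp: spectrum_1 spectrum_mult subsemiring_closed)

end

lemmas spectrum_simps = spectrum_0 spectrum_1 spectrum_add spectrum_mult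

lemma spectrum_UNIV_iff:
  "f \<in> spectrum UNIV le \<longleftrightarrow> (\<forall>x. 0 \<le> f x) \<and> f 0 = 0 \<and> f 1 = 1 \<and>
     (\<forall>x y. f (x + y) = f x + f y) \<and> (\<forall>x y. f (x * y) = f x * f y) \<and>
     (\<forall>x y. le x y \<longrightarrow> f x \<le> f y)"
  by (auto simp: spectrum_def semiring_hom_on_def monotone_on_def)

section \<open>Total Archimedean preorders\<close>

text \<open>
  The homomorphism is read off from Dedekind cuts. Totality supplies, for every \<open>k\<close>, a natural
  number \<open>n\<close> with \<open>n \<preceq> k x \<preceq> n + 1\<close>; all algebraic laws then hold up to an error that
  is negligible compared with \<open>k\<close>.
\<close>

lemma (in preordered_semiring) total_archimedean_spectrum:
  assumes total: "\<And>x y. x \<preceq> y \<or> y \<preceq> x"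
    and embedding: "nat_order_embedding (\<preceq>)"
    and bounded: "\<And>x. \<exists>n::nat. x \<preceq> of_nat n"
  shows "spectrum UNIV (\<preceq>) \<noteq> {}"
proof -
  define f where "f x = Sup {real n / real k | n k. k > 0 \<and> of_nat n \<preceq> of_nat k * x}" for x
  have emb: "of_nat n \<preceq> of_nat m \<longleftrightarrow> n \<le> m" for n m
    using embedding by (simp add: nat_order_embedding_def)
  have cut: "real n / real k \<le> real n' / real k'"
    if "k > 0" "k' > 0" "of_nat n \<preceq> of_nat k * x" "of_nat k' * x \<preceq> of_nat n'" for n k n' k' x
  proof -
    have "of_nat (k' * n) \<preceq> of_nat k' * (of_nat k * x)"
      using mult_left_mono[OF that(3), of "of_nat k'"] by simp
    moreover have "of_nat k' * (of_nat k * x) \<preceq> of_nat (k * n')"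
      using mult_left_mono[OF that(4), of "of_nat k"] by (simp add: algebra_simps)
    ultimately have "k' * n \<le> k * n'"
      using trans emb by blast
    then have "real k' * real n \<le> real k * real n'"
      by (metis of_nat_le_iff of_nat_mult)
    then show ?thesis
      using that(1,2) by (simp add: field_simps)
  qed
  have upper: "real k * f x \<le> real n" if "of_nat k * x \<preceq> of_nat n" for k n x
  proof (cases "k = 0")
    case False
    have "f x \<le> real n / real k"
      unfolding f_def
    proof (rule cSup_least)
      have "\<exists>n k. k > 0 \<and> of_nat n \<preceq> of_nat k * x"
        using zero_le by (intro exI[of _ 0] exI[of _ 1]) simp
      then show "{real n / real k | n k. k > 0 \<and> of_nat n \<preceq> of_nat k * x} \<noteq> {}"
        by blast
    qed (use cut that False in auto)
    then show ?thesis
      using False by (simp add: field_simps)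
  qed simp
  have lower: "real n \<le> real k * f x" if "of_nat n \<preceq> of_nat k * x" for k n x
  proof (cases "k = 0")
    case True
    then show ?thesis
      using that emb[of n 0] by simp
  next
    case False
    obtain N where N: "x \<preceq> of_nat N"
      using bounded by blast
    have "real n / real k \<le> f x"
      unfolding f_def
    proof (rule cSup_upper)
      show "bdd_above {real n / real k | n k. k > 0 \<and> of_nat n \<preceq> of_nat k * x}"
        using cut[of _ 1 _ x N] N by (intro bdd_aboveI[of _ "real N"]) auto
    qed (use that False in auto)
    then show ?thesis
      using False by (simp add: field_simps)
  qed
  have approx: "\<exists>n. of_nat n \<preceq> of_nat k * x \<and> of_nat k * x \<preceq> of_nat (Suc n)" for k x
  proof -
    obtain N where "of_nat k * x \<preceq> of_nat N"
      using bounded by blast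
    then have "\<forall>n. of_nat n \<preceq> of_nat k * x \<longrightarrow> n \<le> N"
      using trans emb by blast
    moreover have "of_nat 0 \<preceq> of_nat k * x"
      by (simp add: zero_le)
    ultimately obtain n where n: "of_nat n \<preceq> of_nat k * x"
      and max: "\<And>n'. of_nat n' \<preceq> of_nat k * x \<Longrightarrow> n' \<le> n"
      using GreatestI_nat[of "\<lambda>n. of_nat n \<preceq> of_nat k * x" 0 N]
        Greatest_le_nat[of "\<lambda>n. of_nat n \<preceq> of_nat k * x" _ N] by blast
    then have "\<not> of_nat (Suc n) \<preceq> of_nat k * x"
      using Suc_n_not_le_n by blast
    with n total show ?thesis
      by blast
  qed
  have mono: "f x \<le> f y" if "x \<preceq> y" for x y
  proof (rule le_if_multiples_le[where c = 1])
    fix k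
    obtain n where n: "of_nat n \<preceq> of_nat k * x" "of_nat k * x \<preceq> of_nat (Suc n)"
      using approx by blast
    have "of_nat n \<preceq> of_nat k * y"
      using n(1) mult_left_mono[OF that] trans by blast
    from upper[OF n(2)] lower[OF this] show "real k * f x \<le> real k * f y + 1"
      by simp
  qed
  have add: "f (x + y) = f x + f y" for x y
  proof -
    have "\<bar>real k * f (x + y) - real k * (f x + f y)\<bar> \<le> 2" for k
    proof -
      obtain n where n: "of_nat n \<preceq> of_nat k * x" "of_nat k * x \<preceq> of_nat (Suc n)"
        using approx by blast
      obtain m where m: "of_nat m \<preceq> of_nat k * y" "of_nat k * y \<preceq> of_nat (Suc m)"
        using approx by blast
      have "real (n + m) \<le> real k * f (x + y)"
        using add_mono[OF n(1) m(1)] by (intro lower) (simp add: algebra_simps)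
      moreover have "real k * f (x + y) \<le> real (Suc n + Suc m)"
        using add_mono[OF n(2) m(2)] by (intro upper) (simp add: algebra_simps)
      ultimately show ?thesis
        using lower[OF n(1)] upper[OF n(2)] lower[OF m(1)] upper[OF m(2)]
        by (simp add: algebra_simps)
    qed
    then have "real k * f (x + y) \<le> real k * (f x + f y) + 2"
      "real k * (f x + f y) \<le> real k * f (x + y) + 2" for k
      by (simp_all add: abs_le_iff algebra_simps)
    then show ?thesis
      by (meson antisym le_if_multiples_le)
  qed
  have one: "f 1 = 1"
    using upper[of 1 1 1] lower[of 1 1 1] refl by simp
  have zero: "f 0 = 0"
    using add[of 0 0] by simp
  have nonneg: "0 \<le> f x" for x
    using mono[OF zero_le, of x] zero by simp
  have mult: "f (x * y) = f x * f y" for x y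
  proof -
    have "\<bar>real k * f (x * y) - real k * (f x * f y)\<bar> \<le> f x + f y + 1" if "k > 0" for k
    proof -
      obtain n where n: "of_nat n \<preceq> of_nat k * x" "of_nat k * x \<preceq> of_nat (Suc n)"
        using approx by blast
      obtain m where m: "of_nat m \<preceq> of_nat k * y" "of_nat k * y \<preceq> of_nat (Suc m)"
        using approx by blast
      note fx = lower[OF n(1)] upper[OF n(2)] and fy = lower[OF m(1)] upper[OF m(2)]
      let ?p = "(real k * f x) * (real k * f y)"
      have "real (n * m) \<le> real (k * k) * f (x * y)"
        using mult_mono[OF n(1) m(1)] by (intro lower) (simp add: algebra_simps)
      moreover have "real (k * k) * f (x * y) \<le> real (Suc n * Suc m)"
        using mult_mono[OF n(2) m(2)] by (intro upper) (simp add: algebra_simps)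
      moreover have "real n * real m \<le> ?p" "?p \<le> real (Suc n) * real (Suc m)"
        using fx fy nonneg by (auto intro!: Rings.mult_mono simp del: of_nat_Suc)
      ultimately have "\<bar>real (k * k) * f (x * y) - ?p\<bar> \<le> real n + real m + 1"
        by (simp add: algebra_simps abs_le_iff)
      also have "\<dots> \<le> real k * (f x + f y + 1)"
        using fx fy that by (simp add: algebra_simps)
      also have "real (k * k) * f (x * y) - ?p = real k * (real k * f (x * y) - real k * (f x * f y))"
        by (simp add: algebra_simps)
      finally show ?thesis
        using that by (simp add: abs_mult)
    qed
    then have "real k * f (x * y) \<le> real k * (f x * f y) + (f x + f y + 1)"
      "real k * (f x * f y) \<le> real k * f (x * y) + (f x + f y + 1)" for k
      using nonneg[of x] nonneg[of y]
      by (cases "k = 0"; force simp: abs_le_iff algebra_simps)+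
    then show ?thesis
      by (meson antisym le_if_multiples_le)
  qed
  have "f \<in> spectrum UNIV (\<preceq>)"
    using nonneg zero one add mult mono by (auto simp: spectrum_UNIV_iff)
  then show ?thesis
    by blast
qed

section \<open>Adjoining an inequality\<close>

text \<open>
  The inequality to be added is \<open>a \<preceq> b\<close>. The relation lets finitely many multiples of it be
  used at once and cancels what they have in common with the rest of the inequality. Even for
  \<open>a = b = 1\<close> it may therefore be larger than the given preorder: addition becomes cancellative.
\<close>

definition adjoin :: "('a::comm_semiring_1 \<Rightarrow> 'a \<Rightarrow> bool) \<Rightarrow> 'a \<Rightarrow> 'a \<Rightarrow> 'a \<Rightarrow> 'a \<Rightarrow> bool" where
  "adjoin le a b v w \<longleftrightarrow> (\<exists>z. le (v + z * b) (w + z * a))"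

context preordered_semiring
begin

lemma adjoin_extends: "v \<preceq> w \<Longrightarrow> adjoin (\<preceq>) a b v w"
  unfolding adjoin_def by (rule exI[of _ 0]) simp

lemma adjoin_new: "adjoin (\<preceq>) a b a b"
  unfolding adjoin_def by (rule exI[of _ 1]) (simp add: add.commute refl)

lemma preordered_semiring_adjoin: "preordered_semiring (adjoin (\<preceq>) a b)"
proof
  fix x y z :: 'a
  assume "adjoin (\<preceq>) a b x y" "adjoin (\<preceq>) a b y z"
  then obtain v w where v: "x + v * b \<preceq> y + v * a" and w: "y + w * b \<preceq> z + w * a"
    unfolding adjoin_def by blast
  have "x + v * b + w * b \<preceq> y + v * a + w * b"
    by (rule add_right_mono[OF v])
  moreover have "y + w * b + v * a \<preceq> z + w * a + v * a"
    by (rule add_right_mono[OF w])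
  ultimately have "x + (v + w) * b \<preceq> z + (v + w) * a"
    using trans by (fastforce simp: algebra_simps)
  then show "adjoin (\<preceq>) a b x z"
    unfolding adjoin_def by blast
next
  fix x y c :: 'a
  assume "adjoin (\<preceq>) a b x y"
  then obtain v where v: "x + v * b \<preceq> y + v * a"
    unfolding adjoin_def by blast
  have "x + c + v * b \<preceq> y + c + v * a"
    using add_right_mono[OF v, of c] by (simp add: ac_simps)
  then show "adjoin (\<preceq>) a b (x + c) (y + c)"
    unfolding adjoin_def by blast
  have "x * c + (v * c) * b \<preceq> y * c + (v * c) * a"
    using mult_right_mono[OF v, of c] by (simp add: algebra_simps)
  then show "adjoin (\<preceq>) a b (x * c) (y * c)"
    unfolding adjoin_def by blast
qed (auto intro: adjoin_extends refl zero_le_one)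

end

section \<open>Extending a monotone homomorphism from a subsemiring\<close>

text \<open>
  The last assumption makes \<open>A\<close> a supply of approximate inverses of the nonzero elements. It
  survives every enlargement of the preorder, so that this locale is also the class of
  preorders in which a maximal one is sought: only the monotonicity of \<open>\<phi>\<close> is at stake.
\<close>

locale normalizing_subsemiring = preordered_semiring le
  for le :: "'a::comm_semiring_1 \<Rightarrow> 'a \<Rightarrow> bool"  (infix "\<preceq>" 50) +
  fixes A :: "'a set" and \<phi> :: "'a \<Rightarrow> real"
  assumes subsemiring_A: "subsemiring A"
    and \<phi>: "\<phi> \<in> spectrum A (\<preceq>)"
    and normalize: "s \<noteq> 0 \<Longrightarrow> \<exists>m\<in>A. \<exists>n::nat. 1 \<preceq> of_nat n * m * s \<and> m * s \<preceq> of_nat n"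
begin

lemmas A_closed [simp] = subsemiring_closed[OF subsemiring_A]
lemmas \<phi>_simps [simp] = spectrum_simps[OF \<phi>] spectrum_of_nat[OF \<phi> subsemiring_A]
  spectrum_power[OF \<phi> subsemiring_A]
lemmas \<phi>_mono = spectrum_mono[OF \<phi>]
lemmas \<phi>_nonneg = spectrum_nonneg[OF \<phi>]

lemma embedding: "nat_order_embedding (\<preceq>)"
  unfolding nat_order_embedding_def using \<phi>_mono[of "of_nat _" "of_nat _"] of_nat_mono by force

lemma not_one_le_zero: "\<not> 1 \<preceq> 0"
  using \<phi>_mono[of 1 0] by auto

lemma \<phi>_pos:
  assumes "s \<in> A" "s \<noteq> 0"
  shows "0 < \<phi> s"
proof -
  obtain m and n :: nat where "m \<in> A" "1 \<preceq> of_nat n * m * s"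
    using normalize[OF assms(2)] by blast
  with \<phi>_mono[of 1 "of_nat n * m * s"] assms(1) have "1 \<le> real n * \<phi> m * \<phi> s"
    by simp
  then have "\<phi> s \<noteq> 0"
    by auto
  with \<phi>_nonneg[OF assms(1)] show ?thesis
    by simp
qed

lemma normalize_pos:
  assumes "z \<noteq> 0"
  obtains m and n :: nat where "m \<in> A" "0 < \<phi> m" "1 \<preceq> of_nat n * m * z" "m * z \<preceq> of_nat n"
proof -
  obtain m and n :: nat where *: "m \<in> A" "1 \<preceq> of_nat n * m * z" "m * z \<preceq> of_nat n"
    using normalize[OF assms] by blast
  then have "m \<noteq> 0"
    using not_one_le_zero by auto
  with * \<phi>_pos that show thesis
    by blast
qed

lemma extension:
  assumes "preordered_semiring R" and "\<And>x y. x \<preceq> y \<Longrightarrow> R x y"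
    and "\<And>x y. x \<in> A \<Longrightarrow> y \<in> A \<Longrightarrow> R x y \<Longrightarrow> \<phi> x \<le> \<phi> y"
  shows "normalizing_subsemiring R A \<phi>"
proof -
  interpret R: preordered_semiring R
    by fact
  show ?thesis
  proof
    show "\<phi> \<in> spectrum A R"
      using \<phi> assms(3) by (auto simp: spectrum_def monotone_on_def)
  qed (use subsemiring_A normalize assms(2) in blast)+
qed

end

text \<open>
  This is the sum of all \<open>s ^ i * t ^ j\<close> with \<open>i + j = N - 1\<close>, the cofactor in the factorization
  of \<open>s ^ N - t ^ N\<close>.
\<close>

fun mixed_powers :: "'a::comm_semiring_1 \<Rightarrow> 'a \<Rightarrow> nat \<Rightarrow> 'a" where
  "mixed_powers s t 0 = 0"
| "mixed_powers s t (Suc N) = t * mixed_powers s t N + s ^ N"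

lemma mixed_powers_telescope:
  "t * mixed_powers s t N + s ^ N = s * mixed_powers s t N + t ^ N"
proof (induction N)
  case (Suc N)
  have "t * mixed_powers s t (Suc N) + s ^ Suc N
      = t * (t * mixed_powers s t N + s ^ N) + s ^ Suc N"
    by simp
  also have "\<dots> = t * (s * mixed_powers s t N + t ^ N) + s ^ Suc N"
    by (simp only: Suc)
  also have "\<dots> = s * (t * mixed_powers s t N + s ^ N) + t ^ Suc N"
    by (simp add: algebra_simps)
  finally show ?case
    by simp
qed simp

context normalizing_subsemiring
begin

lemma mixed_powers_in [simp]: "s \<in> A \<Longrightarrow> t \<in> A \<Longrightarrow> mixed_powers s t N \<in> A"
  by (induction N) auto

lemma \<phi>_mixed_powers_ge:
  assumes "s \<in> A" "t \<in> A" "\<phi> s \<le> \<phi> t"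
  shows "real N * \<phi> s ^ N \<le> \<phi> s * \<phi> (mixed_powers s t N)"
proof (induction N)
  case (Suc N)
  have mono: "\<phi> s * (real N * \<phi> s ^ N) \<le> \<phi> t * (\<phi> s * \<phi> (mixed_powers s t N))"
    by (rule Rings.mult_mono[OF assms(3) Suc]) (use assms \<phi>_nonneg in auto)
  have "real (Suc N) * \<phi> s ^ Suc N = \<phi> s * (real N * \<phi> s ^ N) + \<phi> s * \<phi> s ^ N"
    by (simp add: algebra_simps)
  also have "\<dots> \<le> \<phi> t * (\<phi> s * \<phi> (mixed_powers s t N)) + \<phi> s * \<phi> s ^ N"
    using mono by simp
  also have "\<dots> = \<phi> s * \<phi> (mixed_powers s t (Suc N))"
    using assms by (simp add: algebra_simps)
  finally show ?case .
qed simp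

text \<open>
  The values \<open>\<phi> s \<le> \<phi> t\<close> should force \<open>\<phi> x \<le> \<phi> y\<close> when \<open>x + z t \<preceq> y + z s\<close>, but \<open>z\<close> lies
  outside \<open>A\<close> and is controlled by \<open>A\<close> only up to a constant. Multiplying by
  \<open>G = mixed_powers s t N\<close> telescopes \<open>z t - z s\<close> into \<open>z t ^ N - z s ^ N\<close>; after that the error
  \<open>z s ^ N\<close> is of relative size \<open>1 / N\<close> compared with \<open>G\<close>, since \<open>\<phi> G\<close> is at least
  \<open>N \<phi>(s) ^ (N - 1)\<close>, and the constant does no harm.
\<close>

lemma adjoin_scalar:
  assumes s: "s \<in> A" and t: "t \<in> A" and le: "\<phi> s \<le> \<phi> t"
  shows "normalizing_subsemiring (adjoin (\<preceq>) s t) A \<phi>"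
proof (rule extension[OF preordered_semiring_adjoin adjoin_extends])
  fix x y
  assume x: "x \<in> A" and y: "y \<in> A" and "adjoin (\<preceq>) s t x y"
  then obtain z where z: "x + z * t \<preceq> y + z * s"
    unfolding adjoin_def by blast
  show "\<phi> x \<le> \<phi> y"
  proof (cases "s = 0 \<or> z = 0")
    case True
    then have "x \<preceq> y"
      using z trans[OF le_add_left z] by auto
    then show ?thesis
      using x y \<phi>_mono by blast
  next
    case False
    then have pos: "0 < \<phi> s"
      using \<phi>_pos s by blast
    obtain m and n :: nat where m: "m \<in> A" "0 < \<phi> m" "m * z \<preceq> of_nat n"
      using normalize_pos False by blast
    have "real N * (\<phi> m * \<phi> x) \<le> real N * (\<phi> m * \<phi> y) + real n * \<phi> s" for N
    proof -
      define G where "G = mixed_powers s t N"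
      have G: "G \<in> A"
        using s t by (simp add: G_def)
      \<comment> \<open>the summand common to both sides after telescoping\<close>
      let ?w = "s * z * G"
      have "G * x + ?w \<preceq> G * x + z * (s * G + t ^ N)"
        using le_add_left[of "G * x + ?w" "z * t ^ N"] by (simp add: algebra_simps)
      also have "\<dots> = G * x + z * (t * G + s ^ N)"
        unfolding G_def by (simp only: mixed_powers_telescope)
      also have "\<dots> = G * (x + z * t) + z * s ^ N"
        by (simp add: algebra_simps)
      finally have "G * x + ?w \<preceq> G * (x + z * t) + z * s ^ N" .
      moreover have "G * (x + z * t) + z * s ^ N \<preceq> G * (y + z * s) + z * s ^ N"
        by (intro add_right_mono mult_left_mono z)
      ultimately have step: "G * x + ?w \<preceq> (G * y + z * s ^ N) + ?w"
        using trans by (fastforce simp: algebra_simps)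
      \<comment> \<open>\<open>K\<close> copies of the inequality against a single \<open>?w\<close>, brought into \<open>A\<close> by the factor \<open>m\<close>\<close>
      have "real K * (\<phi> m * \<phi> G * \<phi> x)
          \<le> real K * (\<phi> m * \<phi> G * \<phi> y + real n * \<phi> s ^ N) + real n * (\<phi> s * \<phi> G)" for K
      proof -
        have "m * (of_nat K * (G * x)) \<preceq> m * (of_nat K * (G * x) + ?w)"
          by (intro mult_left_mono le_add_left)
        also have "\<dots> \<preceq> m * (of_nat K * (G * y + z * s ^ N) + ?w)"
          by (intro mult_left_mono iterate_common_summand step)
        also have "\<dots> = of_nat K * (m * (G * y)) + (m * z) * (of_nat K * s ^ N + s * G)"
          by (simp add: algebra_simps)
        also have "\<dots> \<preceq> of_nat K * (m * (G * y)) + of_nat n * (of_nat K * s ^ N + s * G)"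
          by (intro add_left_mono mult_right_mono m)
        finally have "m * (of_nat K * (G * x))
            \<preceq> of_nat K * (m * (G * y)) + of_nat n * (of_nat K * s ^ N + s * G)" .
        from \<phi>_mono[OF _ _ this] show ?thesis
          using m(1) s G x y by (simp add: algebra_simps)
      qed
      then have "\<phi> m * \<phi> G * \<phi> x \<le> \<phi> m * \<phi> G * \<phi> y + real n * \<phi> s ^ N"
        by (rule le_if_multiples_le)
      then have G_le: "\<phi> G * (\<phi> m * (\<phi> x - \<phi> y)) \<le> real n * \<phi> s ^ N"
        by (simp add: algebra_simps)
      have G_ge: "real N * \<phi> s ^ N \<le> \<phi> s * \<phi> G"
        using \<phi>_mixed_powers_ge s t le by (simp add: G_def)
      show ?thesis
      proof (cases "\<phi> x \<le> \<phi> y")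
        case True
        then have "real N * (\<phi> m * \<phi> x) \<le> real N * (\<phi> m * \<phi> y)"
          using m(2) by (intro Rings.mult_left_mono) auto
        moreover have "0 \<le> real n * \<phi> s"
          using pos by simp
        ultimately show ?thesis
          by linarith
      next
        case False
        let ?d = "\<phi> m * (\<phi> x - \<phi> y)"
        have "real N * \<phi> s ^ N * ?d \<le> \<phi> s * \<phi> G * ?d"
          using G_ge False m(2) by (intro Rings.mult_right_mono) auto
        also have "\<dots> \<le> \<phi> s * (real n * \<phi> s ^ N)"
          using Rings.mult_left_mono[OF G_le, of "\<phi> s"] pos by (simp add: algebra_simps)
        finally have "\<phi> s ^ N * (real N * ?d) \<le> \<phi> s ^ N * (real n * \<phi> s)"
          by (simp add: algebra_simps)
        then have "real N * ?d \<le> real n * \<phi> s"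
          using pos by simp
        then show ?thesis
          by (simp add: algebra_simps)
      qed
    qed
    then have "\<phi> m * \<phi> x \<le> \<phi> m * \<phi> y"
      by (rule le_if_multiples_le)
    then show ?thesis
      using m(2) by simp
  qed
qed

context
  assumes maximal: "\<And>R x y. normalizing_subsemiring R A \<phi> \<Longrightarrow> (\<And>v w. v \<preceq> w \<Longrightarrow> R v w)
    \<Longrightarrow> R x y \<Longrightarrow> x \<preceq> y"
begin

lemma maximal_cancel:
  assumes "x + z \<preceq> y + z"
  shows "x \<preceq> y"
proof (rule maximal[OF adjoin_scalar[of 1 1] adjoin_extends])
  show "adjoin (\<preceq>) 1 1 x y"
    using assms by (auto simp: adjoin_def)
qed auto

lemma maximal_contains_scalars:
  assumes "s \<in> A" "t \<in> A" "\<phi> s \<le> \<phi> t"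
  shows "s \<preceq> t"
  by (rule maximal[OF adjoin_scalar[of s t] adjoin_extends]) (use assms adjoin_new in auto)

text \<open>
  If \<open>\<phi> y < \<phi> x\<close>, some multiple of the gap exceeds \<open>1\<close>, so \<open>z x \<preceq> z y\<close> cancels down to
  \<open>z \<preceq> 0\<close>; but a nonzero \<open>z\<close> has a multiple above \<open>1\<close>.
\<close>

lemma maximal_no_strict_decrease:
  assumes "x \<in> A" "y \<in> A" "\<phi> y < \<phi> x" and "z * x \<preceq> z * y"
  shows "z = 0"
proof (rule ccontr)
  assume "z \<noteq> 0"
  then obtain m and n :: nat where m: "m \<in> A" "1 \<preceq> of_nat n * m * z"
    using normalize_pos by blast
  obtain N :: nat where N: "1 < real N * (\<phi> x - \<phi> y)"
    using reals_Archimedean3[of "\<phi> x - \<phi> y"] assms(3) by auto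
  then have "of_nat N * y + 1 \<preceq> of_nat N * x"
    using assms(1,2) by (intro maximal_contains_scalars) (simp_all add: algebra_simps)
  then have "z * (of_nat N * y + 1) \<preceq> z * (of_nat N * x)"
    by (rule mult_left_mono)
  moreover have "z * (of_nat N * x) \<preceq> z * (of_nat N * y)"
    using mult_left_mono[OF assms(4), of "of_nat N"] by (simp add: algebra_simps)
  ultimately have "z * (of_nat N * y + 1) \<preceq> z * (of_nat N * y)"
    by (rule trans)
  then have "z \<preceq> 0"
    using maximal_cancel[of z "z * (of_nat N * y)" 0] by (simp add: algebra_simps)
  then have "of_nat n * m * z \<preceq> 0"
    using mult_left_mono[of z 0 "of_nat n * m"] by simp
  with m(2) not_one_le_zero trans show False
    by blast
qed

text \<open>
  If neither \<open>a \<preceq> b\<close> nor \<open>b \<preceq> a\<close> can be adjoined, each attempt produces a violation of \<open>\<phi>\<close>.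
  Multiplying the two violating inequalities crosswise by \<open>z'\<close> and \<open>z\<close> and adding them makes
  the terms in \<open>a\<close> and \<open>b\<close> equal on both sides, where they cancel.
\<close>

lemma maximal_total: "a \<preceq> b \<or> b \<preceq> a"
proof -
  have obstruction: "\<exists>x y z. x \<in> A \<and> y \<in> A \<and> \<phi> y < \<phi> x \<and> x + z * b \<preceq> y + z * a"
    if "\<not> a \<preceq> b" for a b
  proof (rule ccontr)
    assume "\<not> ?thesis"
    then have "normalizing_subsemiring (adjoin (\<preceq>) a b) A \<phi>"
      by (intro extension preordered_semiring_adjoin adjoin_extends)
        (auto simp: adjoin_def not_less)
    then show False
      using maximal[of "adjoin (\<preceq>) a b" a b] adjoin_extends adjoin_new that by blast
  qed
  show ?thesis
  proof (rule ccontr)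
    assume "\<not> ?thesis"
    then obtain x y z x' y' z'
      where xy: "x \<in> A" "y \<in> A" "\<phi> y < \<phi> x" and z: "x + z * b \<preceq> y + z * a"
        and xy': "x' \<in> A" "y' \<in> A" "\<phi> y' < \<phi> x'" and z': "x' + z' * a \<preceq> y' + z' * b"
      using obstruction[of a b] obstruction[of b a] by blast
    have "z' * (x + z * b) + z * (x' + z' * a) \<preceq> z' * (y + z * a) + z * (y' + z' * b)"
      by (intro add_mono mult_left_mono z z')
    then have "(z' * x + z * x') + z * z' * (a + b) \<preceq> (z' * y + z * y') + z * z' * (a + b)"
      by (simp add: algebra_simps)
    then have sum: "z' * x + z * x' \<preceq> z' * y + z * y'"
      by (rule maximal_cancel)
    have "z' * y \<preceq> z' * x" "z * y' \<preceq> z * x'"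
      using xy xy' by (auto intro!: mult_left_mono maximal_contains_scalars)
    then have "z' * y + z * y' \<preceq> z' * y + z * x'" "z' * y + z * y' \<preceq> z' * x + z * y'"
      by (auto intro: add_left_mono add_right_mono)
    with sum have "z' * x + z * x' \<preceq> z' * y + z * x'" "z' * x + z * x' \<preceq> z' * x + z * y'"
      by (blast intro: trans)+
    then have "z' * x \<preceq> z' * y" "z * x' \<preceq> z * y'"
      using maximal_cancel[of "z' * x" "z * x'" "z' * y"] maximal_cancel[of "z * x'" "z' * x" "z * y'"]
      by (simp_all add: add.commute)
    then have "z = 0" "z' = 0"
      using maximal_no_strict_decrease xy xy' by blast+
    then show False
      using z xy \<phi>_mono[of x y] by simp
  qed
qed

lemma maximal_bounded: "\<exists>n::nat. x \<preceq> of_nat n"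
proof (cases "x = 0")
  case False
  then obtain m and n :: nat where m: "m \<in> A" "0 < \<phi> m" "m * x \<preceq> of_nat n"
    using normalize_pos by blast
  obtain K :: nat where "1 < real K * \<phi> m"
    using reals_Archimedean3[OF m(2)] by auto
  then have "1 \<preceq> of_nat K * m"
    using m(1) by (intro maximal_contains_scalars) auto
  then have "x \<preceq> of_nat K * (m * x)"
    using mult_right_mono[of 1 "of_nat K * m" x] by (simp add: algebra_simps)
  moreover have "of_nat K * (m * x) \<preceq> of_nat (K * n)"
    using mult_left_mono[OF m(3), of "of_nat K"] by simp
  ultimately show ?thesis
    using trans by blast
qed (use zero_le in blast)

lemma maximal_extends_hom: "\<exists>f\<in>spectrum UNIV (\<preceq>). \<forall>a\<in>A. f a = \<phi> a"
proof -
  obtain f where f: "f \<in> spectrum UNIV (\<preceq>)"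
    using total_archimedean_spectrum[OF maximal_total embedding maximal_bounded] by blast
  note f_simps = spectrum_simps[OF f] spectrum_of_nat[OF f subsemiring_UNIV]
  have "f a = \<phi> a" if a: "a \<in> A" for a
  proof (rule antisym)
    \<comment> \<open>both values compare with rational numbers alike, since constants belong to \<open>A\<close>\<close>
    show "f a \<le> \<phi> a"
    proof (rule le_if_multiples_le)
      fix k :: nat
      define n where "n = nat \<lceil>real k * \<phi> a\<rceil>"
      have n: "real k * \<phi> a \<le> real n" "real n \<le> real k * \<phi> a + 1"
        unfolding n_def using \<phi>_nonneg[OF a] by simp_all
      then have "of_nat k * a \<preceq> of_nat n"
        using a by (intro maximal_contains_scalars) auto
      then have "f (of_nat k * a) \<le> f (of_nat n)"
        by (intro spectrum_mono[OF f]) auto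
      then show "real k * f a \<le> real k * \<phi> a + 1"
        using n by (simp add: f_simps)
    qed
    show "\<phi> a \<le> f a"
    proof (rule le_if_multiples_le)
      fix k :: nat
      define n where "n = nat \<lfloor>real k * \<phi> a\<rfloor>"
      have n: "real n \<le> real k * \<phi> a" "real k * \<phi> a \<le> real n + 1"
        unfolding n_def using \<phi>_nonneg[OF a] by simp_all
      then have "of_nat n \<preceq> of_nat k * a"
        using a by (intro maximal_contains_scalars) auto
      then have "f (of_nat n) \<le> f (of_nat k * a)"
        by (intro spectrum_mono[OF f]) auto
      then show "real k * \<phi> a \<le> real k * f a + 1"
        using n by (simp add: f_simps)
    qed
  qed
  with f show ?thesis
    by blast
qed

end

lemma maximal_extension_exists:
  obtains R where "normalizing_subsemiring R A \<phi>" "\<And>x y. x \<preceq> y \<Longrightarrow> R x y"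
    "\<And>R' x y. normalizing_subsemiring R' A \<phi> \<Longrightarrow> (\<And>v w. R v w \<Longrightarrow> R' v w) \<Longrightarrow> R' x y \<Longrightarrow> R x y"
proof -
  let ?E = "{r. {(x, y). x \<preceq> y} \<subseteq> r \<and> normalizing_subsemiring (\<lambda>x y. (x, y) \<in> r) A \<phi>}"
  have "\<exists>r\<in>?E. \<forall>r'\<in>?E. r \<subseteq> r' \<longrightarrow> r' = r"
  proof (rule subset_Zorn_nonempty)
    have "{(x, y). x \<preceq> y} \<in> ?E"
      using normalizing_subsemiring_axioms by simp
    then show "?E \<noteq> {}"
      by blast
  next
    fix \<C>
    assume ne: "\<C> \<noteq> {}" and chain: "subset.chain ?E \<C>"
    have C: "{(x, y). x \<preceq> y} \<subseteq> r" "normalizing_subsemiring (\<lambda>x y. (x, y) \<in> r) A \<phi>"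
      if "r \<in> \<C>" for r
      using chain that by (auto simp: subset_chain_def)
    have pre: "preordered_semiring (\<lambda>x y. (x, y) \<in> r)" if "r \<in> \<C>" for r
      using C(2)[OF that] by (rule normalizing_subsemiring.axioms(1))
    have ext: "(x, y) \<in> \<Union>\<C>" if "x \<preceq> y" for x y
      using ne C(1) that by blast
    have "normalizing_subsemiring (\<lambda>x y. (x, y) \<in> \<Union>\<C>) A \<phi>"
    proof (rule extension)
      show "preordered_semiring (\<lambda>x y. (x, y) \<in> \<Union>\<C>)"
      proof
        fix a b c
        assume "(a, b) \<in> \<Union>\<C>" "(b, c) \<in> \<Union>\<C>"
        then obtain r where "r \<in> \<C>" "(a, b) \<in> r" "(b, c) \<in> r"
          using chain unfolding subset_chain_def by blast
        then show "(a, c) \<in> \<Union>\<C>"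
          using preordered_semiring.trans[OF pre] by blast
      next
        fix a b c
        assume "(a, b) \<in> \<Union>\<C>"
        then obtain r where "r \<in> \<C>" "(a, b) \<in> r"
          by blast
        then show "(a + c, b + c) \<in> \<Union>\<C>" "(a * c, b * c) \<in> \<Union>\<C>"
          using preordered_semiring.add_right_mono[OF pre]
            preordered_semiring.mult_right_mono[OF pre] by blast+
      qed (use ext refl zero_le_one in auto)
    next
      fix x y
      assume "x \<in> A" "y \<in> A" "(x, y) \<in> \<Union>\<C>"
      then show "\<phi> x \<le> \<phi> y"
        using normalizing_subsemiring.\<phi>_mono[OF C(2)] by blast
    qed (rule ext)
    then show "\<Union>\<C> \<in> ?E"
      using ext by auto
  qed
  then obtain r where "r \<in> ?E" and max: "\<forall>r'\<in>?E. r \<subseteq> r' \<longrightarrow> r' = r"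
    by (rule bexE)
  then have r: "{(x, y). x \<preceq> y} \<subseteq> r" "normalizing_subsemiring (\<lambda>x y. (x, y) \<in> r) A \<phi>"
    by simp_all
  show thesis
  proof (rule that[of "\<lambda>x y. (x, y) \<in> r"])
    fix R' x y
    assume R': "normalizing_subsemiring R' A \<phi>" "\<And>v w. (v, w) \<in> r \<Longrightarrow> R' v w" "R' x y"
    have "{(x, y). R' x y} = r"
      by (rule max[rule_format]) (use R' r(1) in auto)
    with R'(3) show "(x, y) \<in> r"
      by blast
  qed (use r in auto)
qed

theorem extend_hom: "\<exists>f\<in>spectrum UNIV (\<preceq>). \<forall>a\<in>A. f a = \<phi> a"
proof -
  obtain R where R: "normalizing_subsemiring R A \<phi>" "\<And>x y. x \<preceq> y \<Longrightarrow> R x y"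
    and max: "\<And>R' x y. normalizing_subsemiring R' A \<phi> \<Longrightarrow> (\<And>v w. R v w \<Longrightarrow> R' v w)
      \<Longrightarrow> R' x y \<Longrightarrow> R x y"
    using maximal_extension_exists by blast
  have "\<exists>f\<in>spectrum UNIV R. \<forall>a\<in>A. f a = \<phi> a"
    by (rule normalizing_subsemiring.maximal_extends_hom[OF R(1)]) (rule max)
  then obtain f where "f \<in> spectrum UNIV R" "\<forall>a\<in>A. f a = \<phi> a"
    by blast
  moreover from this(1) R(2) have "f \<in> spectrum UNIV (\<preceq>)"
    by (simp add: spectrum_UNIV_iff)
  ultimately show ?thesis
    by blast
qed

end

text \<open>
  Extend the canonical real value from the image of the natural numbers, where the
  normalizing factor can always be \<open>1\<close>.
\<close>

lemma (in preordered_semiring) archimedean_spectrum: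
  assumes embedding: "nat_order_embedding (\<preceq>)"
    and archimedean: "\<And>s. s \<noteq> 0 \<Longrightarrow> \<exists>n::nat. 1 \<preceq> of_nat n * s \<and> s \<preceq> of_nat n"
  shows "spectrum UNIV (\<preceq>) \<noteq> {}"
proof -
  have emb: "of_nat n \<preceq> of_nat m \<longleftrightarrow> n \<le> m" for n m
    using embedding by (simp add: nat_order_embedding_def)
  have "inj (of_nat :: nat \<Rightarrow> 'a)"
  proof (rule injI)
    fix n m
    assume "(of_nat n :: 'a) = of_nat m"
    then show "n = m"
      using emb[of n m] emb[of m n] refl by simp
  qed
  then have inv: "inv of_nat (of_nat n :: 'a) = n" for n
    by simp
  define A :: "'a set" where "A = range of_nat"
  define \<phi> :: "'a \<Rightarrow> real" where "\<phi> = (\<lambda>a\<in>A. real (inv of_nat a))"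
  have \<phi>_of_nat: "\<phi> (of_nat n) = real n" for n
    by (simp add: \<phi>_def A_def inv)
  interpret normalizing_subsemiring "(\<preceq>)" A \<phi>
  proof
    have "of_nat n + of_nat m \<in> A" "of_nat n * of_nat m \<in> A" "of_nat n \<in> A" for n m
      unfolding A_def by (metis rangeI of_nat_add, metis rangeI of_nat_mult, rule rangeI)
    from this(1,2) this(3)[of 0] this(3)[of 1] show "subsemiring A"
      by (auto simp: subsemiring_def A_def)
    have "\<phi> \<in> A \<rightarrow>\<^sub>E {0..}"
      by (auto simp: \<phi>_def)
    moreover have "monotone_on A (\<preceq>) (\<le>) \<phi>"
      by (auto simp: monotone_on_def A_def \<phi>_of_nat emb)
    moreover have "semiring_hom_on A \<phi>"
      using \<phi>_of_nat[of 0] \<phi>_of_nat[of 1]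
      by (auto simp: semiring_hom_on_def A_def \<phi>_of_nat simp flip: of_nat_add of_nat_mult)
    ultimately show "\<phi> \<in> spectrum A (\<preceq>)"
      by (simp add: spectrum_def)
    have one: "1 \<in> A"
      unfolding A_def by (metis rangeI of_nat_1)
    fix s :: 'a
    assume "s \<noteq> 0"
    with archimedean show "\<exists>m\<in>A. \<exists>n::nat. 1 \<preceq> of_nat n * m * s \<and> m * s \<preceq> of_nat n"
      by (intro bexI[OF _ one]) simp
  qed
  show ?thesis
    using extend_hom by blast
qed

section \<open>Bounds that are visible on the spectrum\<close>

locale growth_with_normalizers = preordered_semiring le
  for le :: "'a::comm_semiring_1 \<Rightarrow> 'a \<Rightarrow> bool"  (infix "\<preceq>" 50) +
  fixes M :: "'a set"
  assumes growth: "polynomial_growth (\<preceq>)"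
    and embedding: "nat_order_embedding (\<preceq>)"
    and normalizers: "s \<noteq> 0 \<Longrightarrow> \<exists>m\<in>M. \<exists>n::nat. 1 \<preceq> of_nat n * m * s \<and> m * s \<preceq> of_nat n"
    and bounded_normalizers: "m \<in> M \<Longrightarrow>
      bounded (ev m ` spectrum (generated_subsemiring M) (\<preceq>)) \<Longrightarrow> \<exists>n::nat. m \<preceq> of_nat n"
begin

lemma of_nat_preceq_iff: "of_nat n \<preceq> of_nat m \<longleftrightarrow> n \<le> m"
  using embedding by (simp add: nat_order_embedding_def)

lemma normalizer:
  assumes "s \<noteq> 0"
  obtains m and n :: nat where "m \<in> M" "1 \<preceq> of_nat n * (m * s)" "m * s \<preceq> of_nat n"
  using normalizers[OF assms] by (auto simp: mult.assoc)

lemma not_one_le_zero: "\<not> 1 \<preceq> 0"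
  using of_nat_preceq_iff[of 1 0] by simp

lemma mult_nonzero:
  fixes x y :: 'a
  assumes "x \<noteq> 0" "y \<noteq> 0"
  shows "x * y \<noteq> 0"
proof
  assume xy: "x * y = 0"
  obtain m and n :: nat where m: "1 \<preceq> of_nat n * (m * x)"
    using normalizer[OF assms(1)] by blast
  obtain m' and n' :: nat where m': "1 \<preceq> of_nat n' * (m' * y)"
    using normalizer[OF assms(2)] by blast
  have "1 * 1 \<preceq> (of_nat n * (m * x)) * (of_nat n' * (m' * y))"
    by (rule mult_mono[OF m m'])
  also have "\<dots> = of_nat n * of_nat n' * m * m' * (x * y)"
    by (simp add: algebra_simps)
  finally show False
    using xy not_one_le_zero by simp
qed

lemma power_nonzero: "(x :: 'a) \<noteq> 0 \<Longrightarrow> x ^ n \<noteq> 0"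
  by (induction n) (auto simp: mult_nonzero)

lemma restriction_onto:
  assumes "g \<in> spectrum (generated_subsemiring M) (\<preceq>)"
  shows "\<exists>f\<in>spectrum UNIV (\<preceq>). \<forall>a\<in>generated_subsemiring M. f a = g a"
proof -
  interpret normalizing_subsemiring "(\<preceq>)" "generated_subsemiring M" g
  proof
    fix s :: 'a
    assume "s \<noteq> 0"
    from normalizers[OF this] show "\<exists>m\<in>generated_subsemiring M. \<exists>n::nat.
        1 \<preceq> of_nat n * m * s \<and> m * s \<preceq> of_nat n"
      using subset_generated_subsemiring by blast
  qed (rule subsemiring_generated assms)+
  show ?thesis
    by (rule extend_hom)
qed

context
  fixes f
  assumes f: "f \<in> spectrum UNIV (\<preceq>)"
begin

lemmas hom_simps = spectrum_simps[OF f, simplified] spectrum_of_nat[OF f subsemiring_UNIV]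
  spectrum_power[OF f subsemiring_UNIV, simplified]
lemmas hom_mono = spectrum_mono[OF f, simplified]
lemmas hom_nonneg = spectrum_nonneg[OF f, simplified]

lemma hom_pos:
  assumes "x \<noteq> 0"
  shows "0 < f x"
proof -
  obtain m and n :: nat where "1 \<preceq> of_nat n * (m * x)"
    using normalizer[OF assms] by blast
  from hom_mono[OF this] have "1 \<le> real n * (f m * f x)"
    by (simp add: hom_simps)
  then have "f x \<noteq> 0"
    by auto
  with hom_nonneg[of x] show ?thesis
    by simp
qed

end

text \<open>
  With \<open>p\<close> an approximate inverse of \<open>y\<close> and \<open>m\<close> one of \<open>p x\<close>, the element \<open>m \<in> M\<close> plays the
  part of the quotient \<open>y / x\<close>. When the spectrum is empty the hypothesis holds vacuously, and
  then the lemma bounds everything by constants.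
\<close>

theorem spectral_bound:
  assumes x: "x \<noteq> 0" and y: "y \<noteq> 0"
    and bound: "\<And>f. f \<in> spectrum UNIV (\<preceq>) \<Longrightarrow> f y \<le> C * f x"
  shows "\<exists>n::nat. y \<preceq> of_nat n * x"
proof -
  obtain p and n :: nat where p: "1 \<preceq> of_nat n * (p * y)" "p * y \<preceq> of_nat n"
    using normalizer[OF y] by blast
  then have "p \<noteq> 0"
    using not_one_le_zero by auto
  then obtain m and k :: nat
    where m: "m \<in> M" "1 \<preceq> of_nat k * (m * (p * x))" "m * (p * x) \<preceq> of_nat k"
    using normalizer[of "p * x"] mult_nonzero x by blast
  have "m * x \<preceq> (m * x) * (of_nat n * (p * y))"
    using mult_left_mono[OF p(1), of "m * x"] by simp
  also have "\<dots> = of_nat n * y * (m * (p * x))"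
    by (simp add: algebra_simps)
  finally have "m * x \<preceq> of_nat n * y * (m * (p * x))" .
  then have mx: "m * x \<preceq> of_nat n * y * of_nat k"
    using mult_left_mono[OF m(3)] trans by blast
  have m_bound: "f m \<le> real n * C * real k" if f: "f \<in> spectrum UNIV (\<preceq>)" for f
  proof -
    have "f m * f x \<le> real n * f y * real k"
      using hom_mono[OF f mx] by (simp add: hom_simps[OF f])
    also have "\<dots> \<le> real n * (C * f x) * real k"
      using bound[OF f] by (intro Rings.mult_left_mono Rings.mult_right_mono) auto
    finally show ?thesis
      using hom_pos[OF f x] by (simp add: algebra_simps)
  qed
  have "bounded (ev m ` spectrum (generated_subsemiring M) (\<preceq>))"
  proof (rule boundedI)
    fix v
    assume "v \<in> ev m ` spectrum (generated_subsemiring M) (\<preceq>)"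
    then obtain g where g: "g \<in> spectrum (generated_subsemiring M) (\<preceq>)" "v = g m"
      by (auto simp: ev_def)
    then obtain f where "f \<in> spectrum UNIV (\<preceq>)" "f m = g m"
      using restriction_onto m(1) subset_generated_subsemiring by blast
    then show "norm v \<le> real n * C * real k"
      using m_bound[of f] hom_nonneg[of f m] g(2) by simp
  qed
  then obtain N :: nat where N: "m \<preceq> of_nat N"
    using bounded_normalizers m(1) by blast
  have "y \<preceq> y * (of_nat k * (m * (p * x)))"
    using mult_left_mono[OF m(2), of y] by simp
  also have "\<dots> = of_nat k * m * x * (p * y)"
    by (simp add: algebra_simps)
  finally have "y \<preceq> of_nat k * m * x * (p * y)" .
  moreover have "of_nat k * m * x * (p * y) \<preceq> of_nat k * of_nat N * x * of_nat n"
    by (intro mult_mono N p refl)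
  ultimately have "y \<preceq> of_nat (k * N * n) * x"
    using trans by (fastforce simp: algebra_simps)
  then show ?thesis
    by blast
qed

lemma spectrum_nonempty_if_bounded_universal:
  assumes R: "preordered_semiring R" and ext: "\<And>x y. x \<preceq> y \<Longrightarrow> R x y"
    and emb: "nat_order_embedding R"
    and u: "power_universal (\<preceq>) u" and bounded: "R u (of_nat L)"
  shows "spectrum UNIV R \<noteq> {}"
proof -
  interpret R: preordered_semiring R
    by fact
  show ?thesis
  proof (rule R.archimedean_spectrum[OF emb])
    fix s :: 'a
    assume "s \<noteq> 0"
    then obtain k where k: "s \<preceq> u ^ k" "1 \<preceq> u ^ k * s"
      using u by (auto simp: power_universal_def)
    have "R (u ^ k) (of_nat (L ^ k))"
      using R.power_mono[OF bounded, of k] by simp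
    then have "R s (of_nat (L ^ k))" "R 1 (of_nat (L ^ k) * s)"
      using k ext R.trans R.mult_right_mono by blast+
    then show "\<exists>n::nat. R 1 (of_nat n * s) \<and> R s (of_nat n)"
      by blast
  qed
qed

text \<open>
  An empty spectrum would, by the preceding bound, make \<open>u\<close> itself smaller than a constant and
  hence the preorder Archimedean.
\<close>

lemma spectrum_nonempty: "spectrum UNIV (\<preceq>) \<noteq> {}"
proof
  assume empty: "spectrum UNIV (\<preceq>) = {}"
  obtain u where u: "power_universal (\<preceq>) u"
    using growth by (auto simp: polynomial_growth_def)
  have "u \<noteq> 0"
    using u not_one_le_zero by (auto simp: power_universal_def)
  then obtain L :: nat where "u \<preceq> of_nat L * 1"
    using spectral_bound[of 1 u 0] empty by auto
  then have "u \<preceq> of_nat L"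
    by simp
  with spectrum_nonempty_if_bounded_universal[OF preordered_semiring_axioms _ embedding u this] empty
  show False
    by blast
qed

section \<open>Asymptotic comparison\<close>

lemma asymptotic_ge_imp_le:
  assumes u: "power_universal (\<preceq>) u" and asym: "asymptotic_ge (\<preceq>) u x y"
    and f: "f \<in> spectrum UNIV (\<preceq>)"
  shows "f y \<le> f x"
proof (rule ccontr)
  note [simp] = hom_simps[OF f]
  assume "\<not> f y \<le> f x"
  then have less: "f x < f y"
    by simp
  obtain k :: "nat \<Rightarrow> nat" where lim: "(\<lambda>n. real (k n) / real n) \<longlonglongrightarrow> 0"
    and k: "\<And>n. y ^ n \<preceq> u ^ k n * x ^ n"
    using asym by (auto simp: asymptotic_ge_def)
  have "1 \<preceq> u"
    using u by (simp add: power_universal_def)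
  from hom_mono[OF f this] have fu: "1 \<le> f u"
    by simp
  have le: "f y ^ n \<le> f u ^ k n * f x ^ n" for n
    using hom_mono[OF f k[of n]] by simp
  have fx: "0 < f x"
    using le[of 1] hom_nonneg[OF f, of x] less by (cases "f x = 0") auto
  have "ln (f y / f x) \<le> real (k n) / real n * ln (f u)" if "n > 0" for n
  proof -
    have "ln (f y ^ n) \<le> ln (f u ^ k n * f x ^ n)"
      using le[of n] fx less fu by (subst ln_le_cancel_iff) auto
    then have "real n * ln (f y) \<le> real (k n) * ln (f u) + real n * ln (f x)"
      using fx less fu by (simp add: ln_mult ln_realpow)
    then have "real n * ln (f y / f x) \<le> real (k n) * ln (f u)"
      using fx less by (simp add: ln_div algebra_simps)
    then show ?thesis
      using that by (simp add: field_simps)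
  qed
  then have "ln (f y / f x) \<le> 0 * ln (f u)"
    by (intro LIMSEQ_le_const[OF tendsto_mult_right[OF lim]]) (auto intro!: exI[of _ 1])
  then show False
    using fx less by simp
qed

text \<open>
  The factor \<open>4\<close> and the power of \<open>u\<close> next to it do not depend on \<open>q\<close>, only \<open>E\<close> does. For large
  \<open>q\<close> and much larger \<open>n\<close> the total exponent of \<open>u\<close> is therefore small compared with \<open>q n\<close>.
\<close>

lemma power_comparison:
  assumes u: "power_universal (\<preceq>) u" and x: "x \<noteq> 0" and y: "y \<noteq> 0"
    and le: "\<And>f. f \<in> spectrum UNIV (\<preceq>) \<Longrightarrow> f y \<le> f x"
  shows "\<exists>E. \<forall>n. y ^ (q * n) \<preceq> u ^ E * (4 * u) ^ n * x ^ (q * n)"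
proof -
  \<comment> \<open>the \<open>2\<close> makes \<open>f ?a > f ?b\<close> strict even where \<open>f u = 1\<close>\<close>
  let ?a = "2 * u * x ^ q" and ?b = "y ^ q"
  let ?R = "adjoin (\<preceq>) ?a ?b"
  have u1: "1 \<preceq> u"
    using u by (simp add: power_universal_def)
  interpret R: preordered_semiring ?R
    by (rule preordered_semiring_adjoin)
  obtain N :: nat where N: "y \<preceq> of_nat N * x"
    using spectral_bound[OF x y, of 1] le by auto
  obtain m and n :: nat where m: "1 \<preceq> of_nat n * (m * x ^ q)" "m * x ^ q \<preceq> of_nat n"
    using normalizer[OF power_nonzero[OF x]] by blast
  have "?R ?a (of_nat N ^ q * x ^ q)"
    using adjoin_new R.trans adjoin_extends[OF power_mono[OF N, of q]]
    by (simp add: power_mult_distrib) blast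
  then have "?R (of_nat n * m * ?a) (of_nat n * m * (of_nat N ^ q * x ^ q))"
    by (rule R.mult_left_mono)
  moreover have "of_nat n * m * (of_nat N ^ q * x ^ q) \<preceq> of_nat (n * N ^ q * n)"
    using mult_left_mono[OF m(2), of "of_nat (n * N ^ q)"] by (simp add: algebra_simps)
  ultimately have "?R (of_nat n * m * ?a) (of_nat (n * N ^ q * n))"
    using adjoin_extends R.trans by blast
  moreover have "u \<preceq> of_nat n * m * ?a"
  proof -
    have "u \<preceq> u + u"
      by (rule le_add_left)
    moreover have "(u + u) * 1 \<preceq> (u + u) * (of_nat n * (m * x ^ q))"
      by (intro mult_left_mono m)
    moreover have "(u + u) * (of_nat n * (m * x ^ q)) = of_nat n * m * ?a"
      unfolding mult_2[symmetric] by (simp only: ac_simps)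
    ultimately show ?thesis
      using trans by auto
  qed
  ultimately have "?R u (of_nat (n * N ^ q * n))"
    using adjoin_extends R.trans by blast
  note nonempty = spectrum_nonempty_if_bounded_universal[OF preordered_semiring_adjoin adjoin_extends _ u this]
  \<comment> \<open>otherwise \<open>?R\<close> would be Archimedean and have a monotone homomorphism\<close>
  have "\<not> nat_order_embedding ?R"
  proof
    assume "nat_order_embedding ?R"
    then obtain f where fR: "f \<in> spectrum UNIV ?R"
      using nonempty by blast
    then have f: "f \<in> spectrum UNIV (\<preceq>)"
      using adjoin_extends by (simp add: spectrum_UNIV_iff)
    have "f ?a \<le> f ?b"
      using spectrum_mono[OF fR _ _ adjoin_new] by simp
    moreover have "f 2 = 2"
      using spectrum_of_nat[OF f subsemiring_UNIV, of 2] by simp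
    ultimately have "2 * f u * f x ^ q \<le> f y ^ q"
      by (simp add: hom_simps[OF f])
    also have "\<dots> \<le> f x ^ q"
      using le[OF f] hom_nonneg[OF f] by (intro Power.power_mono) auto
    finally have "2 * f u \<le> 1"
      using hom_pos[OF f x] by simp
    moreover have "1 \<le> f u"
      using hom_mono[OF f u1] by (simp add: hom_simps[OF f])
    ultimately show False
      by simp
  qed
  then obtain c d where cd: "?R (of_nat d) (of_nat c)" "c < d"
    using R.of_nat_mono by (auto simp: nat_order_embedding_def not_le)
  then obtain z where "of_nat d + z * ?b \<preceq> of_nat c + z * ?a"
    by (auto simp: adjoin_def)
  moreover have "of_nat (Suc c) + z * ?b \<preceq> of_nat d + z * ?b"
    using cd(2) by (intro add_right_mono of_nat_mono) simp
  ultimately have z: "of_nat (Suc c) + z * ?b \<preceq> of_nat c + z * ?a"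
    using trans by blast
  have z0: "z \<noteq> 0"
    using z of_nat_preceq_iff[of "Suc c" c] by auto
  have "2 \<noteq> (0::'a)"
    using of_nat_preceq_iff[of 2 0] refl by auto
  moreover have "u \<noteq> 0"
    using u1 not_one_le_zero by auto
  ultimately have za0: "z * ?a \<noteq> 0"
    using z0 mult_nonzero power_nonzero[OF x] by metis
  have "\<exists>L::nat. 1 \<preceq> of_nat L * (z * ?a)"
  proof (rule spectral_bound[OF za0 one_neq_zero, of 1])
    fix f
    assume f: "f \<in> spectrum UNIV (\<preceq>)"
    have "real (Suc c) + f (z * ?b) \<le> real c + f (z * ?a)"
      using hom_mono[OF f z] by (simp only: hom_simps[OF f])
    then show "f 1 \<le> 1 * f (z * ?a)"
      using hom_nonneg[OF f, of "z * ?b"] by (simp add: hom_simps(2)[OF f])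
  qed
  then obtain L :: nat where L: "1 \<preceq> of_nat L * (z * ?a)"
    by blast
  \<comment> \<open>\<open>r\<close> copies of \<open>z * ?a\<close> absorb the constant \<open>c\<close>; the successor keeps \<open>r\<close> nonzero\<close>
  define r where "r = Suc (c * L)"
  define v where "v = of_nat r * z"
  have "v * ?b \<preceq> v * (2 * ?a)"
  proof -
    have "of_nat r * (1 + z * ?b) + of_nat c \<preceq> of_nat r * (z * ?a) + of_nat c"
      using z by (intro iterate_common_summand) (simp add: algebra_simps)
    moreover have "of_nat r * (z * ?b) \<preceq> of_nat r * (1 + z * ?b) + of_nat c"
      using le_add_left[of "of_nat r * (z * ?b)" "of_nat r + of_nat c"] by (simp add: algebra_simps)
    moreover have "of_nat r * (z * ?a) + of_nat c \<preceq> of_nat r * (z * ?a) + of_nat r * (z * ?a)"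
    proof (rule add_left_mono)
      have "of_nat c \<preceq> of_nat (c * L) * (z * ?a)"
        using mult_left_mono[OF L, of "of_nat c"] by (simp add: algebra_simps)
      moreover have "of_nat (c * L) * (z * ?a) \<preceq> of_nat r * (z * ?a)"
        by (intro mult_right_mono of_nat_mono) (simp add: r_def)
      ultimately show "of_nat c \<preceq> of_nat r * (z * ?a)"
        by (rule trans)
    qed
    ultimately have "of_nat r * (z * ?b) \<preceq> of_nat r * (z * ?a) + of_nat r * (z * ?a)"
      using trans by blast
    also have "\<dots> = v * (2 * ?a)"
      unfolding v_def mult_2[of ?a] by (simp only: distrib_left mult.assoc)
    finally show ?thesis
      by (simp only: v_def mult.assoc)
  qed
  then have iter: "v * ?b ^ n \<preceq> v * (2 * ?a) ^ n" for n
    by (rule iterate_common_factor)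
  have "of_nat r \<noteq> (0::'a)"
    using of_nat_preceq_iff[of r 0] refl by (auto simp: r_def)
  then have "v \<noteq> 0"
    unfolding v_def using z0 mult_nonzero by blast
  then obtain k where k: "v \<preceq> u ^ k" "1 \<preceq> u ^ k * v"
    using u by (auto simp: power_universal_def)
  have "y ^ (q * n) \<preceq> u ^ (k + k) * (4 * u) ^ n * x ^ (q * n)" for n
  proof -
    have "?b ^ n \<preceq> (u ^ k * v) * ?b ^ n"
      using mult_right_mono[OF k(2)] by fastforce
    moreover have "(u ^ k * v) * ?b ^ n \<preceq> u ^ k * (v * (2 * ?a) ^ n)"
      using mult_left_mono[OF iter] by (simp add: mult.assoc)
    moreover have "u ^ k * (v * (2 * ?a) ^ n) \<preceq> u ^ k * (u ^ k * (2 * ?a) ^ n)"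
      by (intro mult_left_mono mult_right_mono k)
    ultimately have "?b ^ n \<preceq> u ^ k * (u ^ k * (2 * ?a) ^ n)"
      using trans by blast
    also have "2 * ?a = 4 * u * x ^ q"
      by (simp add: algebra_simps)
    finally show ?thesis
      by (simp only: power_mult power_mult_distrib power_add mult.assoc)
  qed
  then show ?thesis
    by blast
qed

text \<open>
  The least admissible exponents serve as \<open>k n\<close>. Dividing \<open>n\<close> by \<open>q\<close> with remainder shows that
  they are at most \<open>O(1 / q) n\<close> up to a constant, for each fixed \<open>q\<close>, hence sublinear.
\<close>

lemma le_imp_asymptotic_ge:
  assumes u: "power_universal (\<preceq>) u"
    and le: "\<And>f. f \<in> spectrum UNIV (\<preceq>) \<Longrightarrow> f y \<le> f x"
  shows "asymptotic_ge (\<preceq>) u x y"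
proof (cases "y = 0")
  case True
  have "y ^ n \<preceq> u ^ 0 * x ^ n" for n
    using True zero_le refl by (cases n) auto
  then show ?thesis
    unfolding asymptotic_ge_def by (intro exI[of _ "\<lambda>_. 0"]) simp
next
  case y: False
  have x: "x \<noteq> 0"
  proof
    assume "x = 0"
    moreover obtain f where "f \<in> spectrum UNIV (\<preceq>)"
      using spectrum_nonempty by blast
    ultimately show False
      using hom_pos[of f y] le[of f] y spectrum_0[of f UNIV "(\<preceq>)"] by force
  qed
  have u1: "1 \<preceq> u"
    using u by (simp add: power_universal_def)
  have absorb: "\<exists>k. w \<preceq> u ^ k" for w
    using u zero_le by (cases "w = 0") (auto simp: power_universal_def)
  obtain N :: nat where N: "y \<preceq> of_nat N * x"
    using spectral_bound[OF x y, of 1] le by auto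
  obtain i where i: "of_nat N \<preceq> u ^ i"
    using absorb by blast
  obtain j where j: "4 \<preceq> u ^ j"
    using absorb by blast
  have yx: "y \<preceq> u ^ i * x"
    using N i mult_right_mono trans by blast
  have yx_power: "y ^ r \<preceq> u ^ (i * r) * x ^ r" for r
    using power_mono[OF yx, of r] by (simp add: power_mult power_mult_distrib)
  define k where "k n = (LEAST k. y ^ n \<preceq> u ^ k * x ^ n)" for n
  have k: "y ^ n \<preceq> u ^ k n * x ^ n" for n
    unfolding k_def using yx_power by (rule LeastI)
  have k_le: "\<exists>E. \<forall>n. real (k n) \<le> real E + real (Suc j) / real q * real n" if q: "q > 0" for q
  proof -
    obtain E where E: "\<And>n. y ^ (q * n) \<preceq> u ^ E * (4 * u) ^ n * x ^ (q * n)"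
      using power_comparison[OF u x y le] by blast
    have "real (k n) \<le> real (E + i * q) + real (Suc j) / real q * real n" for n
    proof -
      define d r where "d = n div q" and "r = n mod q"
      have n: "n = q * d + r" and r: "r \<le> q"
        using q by (simp_all add: d_def r_def less_imp_le)
      have "4 * u \<preceq> u ^ Suc j"
        using mult_right_mono[OF j] by (simp add: mult.commute)
      then have "(4 * u) ^ d \<preceq> u ^ (Suc j * d)"
        unfolding power_mult by (rule power_mono)
      then have "u ^ E * (4 * u) ^ d * x ^ (q * d) \<preceq> u ^ E * u ^ (Suc j * d) * x ^ (q * d)"
        by (intro mult_left_mono mult_right_mono)
      then have block: "y ^ (q * d) \<preceq> u ^ E * u ^ (Suc j * d) * x ^ (q * d)"
        using E trans by blast
      have "u ^ (i * r) \<preceq> u ^ (i * q)"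
        using r by (intro power_increasing u1) simp
      then have rest: "y ^ r \<preceq> u ^ (i * q) * x ^ r"
        using yx_power mult_right_mono trans by blast
      have "y ^ n \<preceq> u ^ (E + i * q + Suc j * d) * x ^ n"
        using mult_mono[OF block rest] by (simp add: n power_add algebra_simps)
      then have "k n \<le> E + i * q + Suc j * d"
        unfolding k_def by (rule Least_le)
      then have "real (k n) \<le> real (E + i * q) + real (Suc j) * real d"
        by (metis of_nat_add of_nat_le_iff of_nat_mult)
      also have "real q * real d \<le> real n"
        unfolding n by simp
      then have "real d \<le> real n / real q"
        using q by (simp add: field_simps)
      then have "real (Suc j) * real d \<le> real (Suc j) / real q * real n"
        using Rings.mult_left_mono[of "real d" "real n / real q" "real (Suc j)"] by simp
      finally show ?thesis
        by simp
    qed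
    then show ?thesis
      by blast
  qed
  have "(\<lambda>n. real (k n) / real n) \<longlonglongrightarrow> 0"
  proof (rule LIMSEQ_I)
    fix e :: real
    assume e: "e > 0"
    from e have "e / 2 > 0"
      by simp
    then obtain q :: nat where q: "real (Suc j) < real q * (e / 2)"
      using reals_Archimedean3 by blast
    then have "q > 0"
      by (cases q) auto
    with q have qe: "real (Suc j) / real q < e / 2"
      by (simp add: field_simps)
    obtain E where E: "\<And>n. real (k n) \<le> real E + real (Suc j) / real q * real n"
      using k_le[OF \<open>q > 0\<close>] by blast
    obtain n0 :: nat where n0: "real E < real n0 * (e / 2)"
      using reals_Archimedean3[OF \<open>e / 2 > 0\<close>] by blast
    have "norm (real (k n) / real n - 0) < e" if n: "n \<ge> Suc n0" for n
    proof -
      have "real n0 * (e / 2) \<le> real n * (e / 2)"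
        using n e by (intro Rings.mult_right_mono) auto
      with n0 have "real E < real n * (e / 2)"
        by linarith
      moreover have "real (Suc j) / real q * real n \<le> e / 2 * real n"
        using qe by (intro Rings.mult_right_mono) auto
      ultimately have "real (k n) < real n * (e / 2) + e / 2 * real n"
        using E[of n] by linarith
      then have "real (k n) < e * real n"
        by (simp add: mult.commute)
      then show ?thesis
        using n by (simp add: field_simps)
    qed
    then show "\<exists>n0. \<forall>n\<ge>n0. norm (real (k n) / real n - 0) < e"
      by blast
  qed
  with k show ?thesis
    unfolding asymptotic_ge_def by blast
qed

end

section \<open>The topology of the spectrum\<close>

text \<open>
  The topology on functions is that of pointwise convergence, so its restriction to the
  spectrum is the initial topology of the evaluations, and Tychonoff's theorem becomes available.
\<close>

lemma spectrum_topology_UNIV: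
  fixes le :: "'a::comm_semiring_1 \<Rightarrow> 'a \<Rightarrow> bool"
  shows "spectrum_topology UNIV le = top_of_set (spectrum UNIV le)"
proof -
  let ?X = "spectrum_topology UNIV le" and ?Y = "top_of_set (spectrum UNIV le)"
  have space: "topspace ?X = spectrum UNIV le"
    by (simp add: topspace_spectrum_topology)
  have "continuous_map ?Y ?X id"
    unfolding spectrum_topology_def
  proof (rule continuous_on_generated_topo)
    fix W
    assume "W \<in> {{f \<in> spectrum UNIV le. ev s f \<in> U} | s U. s \<in> UNIV \<and> openin nonneg_reals U}"
    then obtain s T where T: "open T" and W: "W = {f \<in> spectrum UNIV le. f s \<in> {0..} \<inter> T}"
      by (auto simp: ev_def openin_open)
    have "W = spectrum UNIV le \<inter> (\<lambda>f. f s) -` T"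
      unfolding W by (auto simp: spectrum_UNIV_iff)
    moreover have "open ((\<lambda>f :: 'a \<Rightarrow> real. f s) -` T)"
      using T by (intro open_vimage continuous_on_product_coordinates)
    ultimately show "openin ?Y (id -` W \<inter> topspace ?Y)"
      by (auto simp: openin_open)
  qed (use space in \<open>auto simp: spectrum_topology_def\<close>)
  moreover have "continuous_map ?X ?Y id"
  proof -
    have "continuous_map ?X euclideanreal (\<lambda>f. f s)" for s
      unfolding continuous_map_def
    proof (intro conjI allI impI)
      fix U :: "real set"
      assume "openin euclidean U"
      then have "openin nonneg_reals ({0..} \<inter> U)"
        by (auto simp: openin_open)
      then have "openin ?X {f \<in> spectrum UNIV le. ev s f \<in> {0..} \<inter> U}"
        unfolding spectrum_topology_def by (intro topology_generated_by_Basis) blast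
      also have "{f \<in> spectrum UNIV le. ev s f \<in> {0..} \<inter> U} = {f \<in> topspace ?X. f s \<in> U}"
        unfolding space by (auto simp: ev_def spectrum_UNIV_iff)
      finally show "openin ?X {f \<in> topspace ?X. f s \<in> U}" .
    qed simp
    then have "continuous_map ?X euclidean id"
      unfolding euclidean_product_topology[symmetric] continuous_map_componentwise_UNIV by simp
    then show ?thesis
      using space by (simp add: continuous_map_in_subtopology)
  qed
  ultimately have "openin ?X U \<longleftrightarrow> openin ?Y U" for U
    using space openin_subset[of ?X U] openin_subset[of ?Y U]
    by (auto simp: continuous_map_alt Int_absorb2 dest!: spec[of _ U])
  then show ?thesis
    by (simp add: topology_eq)
qed

lemma Hausdorff_spectrum: "Hausdorff_space (spectrum_topology UNIV le)"
proof -
  have "Hausdorff_space (product_topology (\<lambda>_. euclideanreal) UNIV)"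
    unfolding Hausdorff_space_product_topology by simp
  then show ?thesis
    unfolding spectrum_topology_UNIV euclidean_product_topology
    by (rule Hausdorff_space_subtopology)
qed

lemma closed_spectrum: "closed (spectrum UNIV le)"
proof -
  have "closed {f. (\<forall>x. 0 \<le> f x) \<and> f 0 = (0::real) \<and> f 1 = 1 \<and>
     (\<forall>x y. f (x + y) = f x + f y) \<and> (\<forall>x y. f (x * y) = f x * f y) \<and>
     (\<forall>x y. le x y \<longrightarrow> f x \<le> f y)}"
    by (intro closed_Collect_conj closed_Collect_all closed_Collect_imp open_Collect_const
        closed_Collect_le closed_Collect_eq continuous_intros continuous_on_product_coordinates)
  also have "\<dots> = spectrum UNIV le"
    by (auto simp: spectrum_UNIV_iff)
  finally show ?thesis .
qed

context preordered_semiring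
begin

text \<open>
  Every \<open>x\<close> lies below a power of \<open>u\<close>, so a bound on \<open>f u\<close> confines \<open>f\<close> to a product of
  compact intervals.
\<close>

lemma compact_spectrum_vimage:
  assumes u: "power_universal (\<preceq>) u" and K: "compact K"
  shows "compact {f \<in> spectrum UNIV (\<preceq>). f u \<in> K}"
proof -
  obtain c where c: "\<And>v. v \<in> K \<Longrightarrow> v \<le> c"
    using compact_imp_bounded[OF K] by (metis abs_le_D1 bounded_real)
  have "\<exists>k. x \<preceq> u ^ k" for x
    using u zero_le by (cases "x = 0") (auto simp: power_universal_def)
  then obtain k where k: "\<And>x. x \<preceq> u ^ k x"
    by metis
  let ?B = "\<Pi>\<^sub>E x\<in>UNIV. {0..c ^ k x}"
  have "compactin (product_topology (\<lambda>_. euclideanreal) UNIV) ?B"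
    unfolding compactin_PiE by simp
  then have "compact ?B"
    by (simp add: euclidean_product_topology)
  moreover have "closed (spectrum UNIV (\<preceq>) \<inter> (\<lambda>f. f u) -` K)"
    using K by (intro closed_Int closed_spectrum closed_vimage compact_imp_closed
        continuous_on_product_coordinates)
  ultimately have "compact ((spectrum UNIV (\<preceq>) \<inter> (\<lambda>f. f u) -` K) \<inter> ?B)"
    by (rule closed_Int_compact[rotated])
  moreover have "f \<in> ?B" if f: "f \<in> spectrum UNIV (\<preceq>)" "f u \<in> K" for f
  proof -
    have "f x \<le> c ^ k x" for x
    proof -
      have "f x \<le> f u ^ k x"
        using spectrum_mono[OF f(1) _ _ k] spectrum_power[OF f(1) subsemiring_UNIV] by simp
      also have "\<dots> \<le> c ^ k x"
        using c f spectrum_nonneg[OF f(1)] by (intro Power.power_mono) auto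
      finally show ?thesis .
    qed
    then show ?thesis
      using spectrum_nonneg[OF f(1)] by auto
  qed
  then have "(spectrum UNIV (\<preceq>) \<inter> (\<lambda>f. f u) -` K) \<inter> ?B = {f \<in> spectrum UNIV (\<preceq>). f u \<in> K}"
    by blast
  ultimately show ?thesis
    by simp
qed

lemma proper_evaluation:
  assumes "power_universal (\<preceq>) u"
  shows "compact_preimage_map (spectrum_topology UNIV (\<preceq>)) nonneg_reals (ev u)"
  unfolding compact_preimage_map_def spectrum_topology_UNIV
  using compact_spectrum_vimage[OF assms]
  by (auto simp: compactin_subtopology ev_def spectrum_UNIV_iff)

lemma locally_compact_spectrum:
  assumes u: "power_universal (\<preceq>) u"
  shows "locally_compact_space (spectrum_topology UNIV (\<preceq>))"
  unfolding locally_compact_space_def spectrum_topology_UNIV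
proof
  let ?\<Delta> = "spectrum UNIV (\<preceq>)"
  fix f
  assume "f \<in> topspace (top_of_set ?\<Delta>)"
  then have f: "f \<in> ?\<Delta>"
    by simp
  let ?U = "?\<Delta> \<inter> (\<lambda>g. g u) -` {..<f u + 1}" and ?K = "{g \<in> ?\<Delta>. g u \<in> {0..f u + 1}}"
  have "open ((\<lambda>g :: 'a \<Rightarrow> real. g u) -` {..<f u + 1})"
    by (intro open_vimage continuous_on_product_coordinates) simp
  then have "openin (top_of_set ?\<Delta>) ?U"
    by (rule openin_open_Int)
  moreover have "compactin (top_of_set ?\<Delta>) ?K"
    using compact_spectrum_vimage[OF u, of "{0..f u + 1}"] by (auto simp: compactin_subtopology)
  moreover have "?U \<subseteq> ?K"
    by (auto simp: spectrum_UNIV_iff)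
  ultimately show "\<exists>U K. openin (top_of_set ?\<Delta>) U \<and> compactin (top_of_set ?\<Delta>) K \<and> f \<in> U \<and> U \<subseteq> K"
    using f by (intro exI[of _ ?U] exI[of _ ?K]) auto
qed

end

section \<open>The spectrum characterizes the asymptotic preorder\<close>

theorem theorem1p2:
  fixes le :: "'a::comm_semiring_1 \<Rightarrow> 'a \<Rightarrow> bool"  (infix "\<preceq>" 50)
    and M :: "'a set"
  assumes "preordered_semiring (\<preceq>)"
    and "polynomial_growth (\<preceq>)"
    and "nat_order_embedding (\<preceq>)"
    and M1: "\<forall>s. s \<noteq> 0 \<longrightarrow>
      (\<exists>m\<in>M. \<exists>n::nat. 1 \<preceq> of_nat n * m * s \<and> m * s \<preceq> of_nat n)"
    and M2: "\<forall>m\<in>M. bounded (ev m ` spectrum (generated_subsemiring M) (\<preceq>)) \<longrightarrow>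
      (\<exists>n::nat. m \<preceq> of_nat n)"
  shows "(\<forall>u. power_universal (\<preceq>) u \<longrightarrow>
           (\<forall>x y. asymptotic_ge (\<preceq>) u x y \<longleftrightarrow> (\<forall>f\<in>spectrum UNIV (\<preceq>). f x \<ge> f y)))
       \<and> spectrum UNIV (\<preceq>) \<noteq> {}
       \<and> locally_compact_space (spectrum_topology UNIV (\<preceq>))
       \<and> Hausdorff_space (spectrum_topology UNIV (\<preceq>))
       \<and> (\<forall>u. power_universal (\<preceq>) u \<longrightarrow>
           compact_preimage_map (spectrum_topology UNIV (\<preceq>)) nonneg_reals (ev u))"
proof -
  interpret growth_with_normalizers "(\<preceq>)" M
    using assms by (intro growth_with_normalizers.intro growth_with_normalizers_axioms.intro) auto
  obtain u where "power_universal (\<preceq>) u"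
    using growth by (auto simp: polynomial_growth_def)
  then have "locally_compact_space (spectrum_topology UNIV (\<preceq>))"
    by (rule locally_compact_spectrum)
  moreover have "asymptotic_ge (\<preceq>) u x y \<longleftrightarrow> (\<forall>f\<in>spectrum UNIV (\<preceq>). f x \<ge> f y)"
    if "power_universal (\<preceq>) u" for u x y
    using asymptotic_ge_imp_le[OF that] le_imp_asymptotic_ge[OF that] by blast
  ultimately show ?thesis
    using spectrum_nonempty Hausdorff_spectrum proper_evaluation by blast
qed

end
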